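(* For every $n\ge 2$, the Lie algebra $\mathfrak{u}_n$ is locally finite dimensional and locally nilpotent; that is, every finitely generated Lie subalgebra of $\mathfrak{u}_n$ is finite dimensional and nilpotent.
   Context: $K$ is a field of characteristic zero, $P_0=K$, $P_i=K[x_1,\ldots,x_i]$, $\partial_i=\partial/\partial x_i$. For $n\ge 2$, $\mathfrak{u}_n=K\partial_1+P_1\partial_2+\cdots+P_{n-1}\partial_n$, a Lie subalgebra of $\mathrm{Der}_K(P_n)$. A Lie algebra is called locally nilpotent (respectively, locally finite dimensional) if every finitely generated Lie subalgebra of it is nilpotent (respectively, finite dimensional). *)

theory Defs
  imports Complex_Main "HOL-Library.Poly_Mapping" "HOL-Library.Function_Algebras"
begin

section \<open>Lie algebras over a field\<close>

text \<open>
  The Lie algebra is a carrier set \<open>L\<close> inside an ambient vector space; the axioms for the bracket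
  are only required on \<open>L\<close>.
\<close>

locale lie_algebra = vector_space scale
  for scale :: "'k::field \<Rightarrow> 'v::ab_group_add \<Rightarrow> 'v" (infixr \<open>*s\<close> 75) +
  fixes L :: "'v set" and bracket :: "'v \<Rightarrow> 'v \<Rightarrow> 'v"
  assumes subspace_carrier: "subspace L"
    and bracket_closed: "x \<in> L \<Longrightarrow> y \<in> L \<Longrightarrow> bracket x y \<in> L"
    and bracket_add_left:
      "x \<in> L \<Longrightarrow> y \<in> L \<Longrightarrow> z \<in> L \<Longrightarrow> bracket (x + y) z = bracket x z + bracket y z"
    and bracket_add_right:
      "x \<in> L \<Longrightarrow> y \<in> L \<Longrightarrow> z \<in> L \<Longrightarrow> bracket x (y + z) = bracket x y + bracket x z"
    and bracket_scale_left: "x \<in> L \<Longrightarrow> y \<in> L \<Longrightarrow> bracket (c *s x) y = c *s bracket x y"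
    and bracket_scale_right: "x \<in> L \<Longrightarrow> y \<in> L \<Longrightarrow> bracket x (c *s y) = c *s bracket x y"
    and bracket_self: "x \<in> L \<Longrightarrow> bracket x x = 0"
    and jacobi: "x \<in> L \<Longrightarrow> y \<in> L \<Longrightarrow> z \<in> L \<Longrightarrow>
      bracket x (bracket y z) + bracket y (bracket z x) + bracket z (bracket x y) = 0"
begin

definition lie_subalgebra :: "'v set \<Rightarrow> bool" where
  "lie_subalgebra M \<longleftrightarrow> subspace M \<and> M \<subseteq> L \<and> (\<forall>x\<in>M. \<forall>y\<in>M. bracket x y \<in> M)"

definition finitely_generated :: "'v set \<Rightarrow> bool" where
  "finitely_generated M \<longleftrightarrow> (\<exists>X. finite X \<and> X \<subseteq> L \<and> M = lie_subalgebra hull X)"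

definition finite_dimensional :: "'v set \<Rightarrow> bool" where
  "finite_dimensional M \<longleftrightarrow> (\<exists>B. finite B \<and> M = span B)"

primrec lower_central :: "'v set \<Rightarrow> nat \<Rightarrow> 'v set" where
  "lower_central M 0 = M"
| "lower_central M (Suc k) = span {bracket x y | x y. x \<in> M \<and> y \<in> lower_central M k}"

definition nilpotent :: "'v set \<Rightarrow> bool" where
  "nilpotent M \<longleftrightarrow> (\<exists>k. lower_central M k = {0})"

definition locally_finite_dimensional :: bool where
  "locally_finite_dimensional \<longleftrightarrow> (\<forall>M. finitely_generated M \<longrightarrow> finite_dimensional M)"

definition locally_nilpotent :: bool where
  "locally_nilpotent \<longleftrightarrow> (\<forall>M. finitely_generated M \<longrightarrow> nilpotent M)"

lemma lie_algebra_subalgebra: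
  assumes "lie_subalgebra M"
  shows "lie_algebra scale M bracket"
  using assms bracket_add_left bracket_add_right bracket_scale_left bracket_scale_right
    bracket_self jacobi
  unfolding lie_subalgebra_def by unfold_locales (auto simp: subset_iff)

end


section \<open>Polynomials and derivations\<close>

text \<open>
  Polynomials over \<open>K\<close> in the variables \<open>x\<^sub>0, x\<^sub>1, x\<^sub>2, \<dots>\<close>, as finitely supported functions
  from exponent vectors to coefficients. Variable \<open>x\<^sub>0\<close> is not used below.
\<close>

type_synonym 'k mpoly = "(nat \<Rightarrow>\<^sub>0 nat) \<Rightarrow>\<^sub>0 'k"

definition const :: "'k::zero \<Rightarrow> 'k mpoly" where
  "const c = Poly_Mapping.single 0 c"

text \<open>\<open>Pol i\<close> is \<open>K[x\<^sub>1, \<dots>, x\<^sub>i]\<close>; in particular \<open>Pol 0\<close> consists of the constants.\<close>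

definition Pol :: "nat \<Rightarrow> 'k::zero mpoly set" where
  "Pol i = {p. \<forall>m\<in>Poly_Mapping.keys p. Poly_Mapping.keys m \<subseteq> {1..i}}"

text \<open>
  Monomial by monomial, \<open>c x\<^bsup>m\<^esup> \<mapsto> m\<^sub>i c x\<^bsup>m - e\<^sub>i\<^esup>\<close>. If \<open>m\<^sub>i = 0\<close> the exponent \<open>m - e\<^sub>i\<close> is truncated
  to \<open>m\<close>, but the coefficient is zero.
\<close>

definition pderiv_var :: "nat \<Rightarrow> 'k::comm_ring_1 mpoly \<Rightarrow> 'k mpoly" where
  "pderiv_var i p = (\<Sum>m\<in>Poly_Mapping.keys p.
     Poly_Mapping.single (m - Poly_Mapping.single i 1)
       (of_nat (Poly_Mapping.lookup m i) * Poly_Mapping.lookup p m))"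

text \<open>
  Maps \<open>Pol n \<rightarrow> Pol n\<close> are represented by functions on all polynomials that vanish outside \<open>Pol n\<close>.
  As the derivations below map \<open>0\<close> to \<open>0\<close>, this convention is compatible with pointwise
  addition, pointwise scaling and commutators.
\<close>

definition Der :: "nat \<Rightarrow> ('k::comm_ring_1 mpoly \<Rightarrow> 'k mpoly) set" where
  "Der n = {\<delta>. (\<forall>f. f \<notin> Pol n \<longrightarrow> \<delta> f = 0) \<and> (\<forall>f\<in>Pol n. \<delta> f \<in> Pol n) \<and>
     (\<forall>f\<in>Pol n. \<forall>g\<in>Pol n. \<delta> (f + g) = \<delta> f + \<delta> g) \<and>
     (\<forall>c. \<forall>f\<in>Pol n. \<delta> (const c * f) = const c * \<delta> f) \<and>
     (\<forall>f\<in>Pol n. \<forall>g\<in>Pol n. \<delta> (f * g) = \<delta> f * g + f * \<delta> g)}"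

definition scale_map :: "'k::comm_ring_1 \<Rightarrow> ('k mpoly \<Rightarrow> 'k mpoly) \<Rightarrow> 'k mpoly \<Rightarrow> 'k mpoly" where
  "scale_map c \<delta> = (\<lambda>f. const c * \<delta> f)"

definition commutator ::
  "('k::comm_ring_1 mpoly \<Rightarrow> 'k mpoly) \<Rightarrow> ('k mpoly \<Rightarrow> 'k mpoly) \<Rightarrow> 'k mpoly \<Rightarrow> 'k mpoly" where
  "commutator \<delta> \<epsilon> = (\<lambda>f. \<delta> (\<epsilon> f) - \<epsilon> (\<delta> f))"

text \<open>\<open>\<partial>\<^sub>i\<close> as an element of \<open>Der n\<close>.\<close>

definition partial_der :: "nat \<Rightarrow> nat \<Rightarrow> 'k::comm_ring_1 mpoly \<Rightarrow> 'k mpoly" where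
  "partial_der n i = (\<lambda>f. if f \<in> Pol n then pderiv_var i f else 0)"

definition \<uu> :: "nat \<Rightarrow> ('k::comm_ring_1 mpoly \<Rightarrow> 'k mpoly) set" where
  "\<uu> n = {\<lambda>f. \<Sum>i=1..n. p i * partial_der n i f | p. \<forall>i\<in>{1..n}. p i \<in> Pol (i - 1)}"


subsection \<open>The Lie algebra of derivations and its subalgebra \<open>\<uu> n\<close>\<close>

lemma P_0 [simp]: "0 \<in> Pol n"
  by (simp add: Pol_def)

lemma P_add: "f \<in> Pol n \<Longrightarrow> g \<in> Pol n \<Longrightarrow> f + g \<in> Pol n"
  using keys_add[of f g] unfolding Pol_def by blast

lemma P_uminus: "f \<in> Pol n \<Longrightarrow> - f \<in> Pol (n::nat)" for f :: "'k::comm_ring_1 mpoly"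
  by (auto simp: Pol_def in_keys_iff)

lemma P_diff: "f \<in> Pol n \<Longrightarrow> g \<in> Pol n \<Longrightarrow> f - g \<in> Pol n" for f :: "'k::comm_ring_1 mpoly"
  using P_add[of f n "- g"] P_uminus[of g n] by simp

lemma P_mult: "f \<in> Pol n \<Longrightarrow> g \<in> Pol n \<Longrightarrow> f * g \<in> Pol n" for f :: "'k::comm_ring_1 mpoly"
proof -
  assume *: "f \<in> Pol n" "g \<in> Pol n"
  have "Poly_Mapping.keys m \<subseteq> {1..n}" if m: "m \<in> Poly_Mapping.keys (f * g)" for m
  proof -
    obtain a b where ab: "m = a + b" "a \<in> Poly_Mapping.keys f" "b \<in> Poly_Mapping.keys g"
      using m keys_mult[of f g] by blast
    have "Poly_Mapping.keys m \<subseteq> Poly_Mapping.keys a \<union> Poly_Mapping.keys b"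
      unfolding ab(1) by (rule keys_add)
    also have "\<dots> \<subseteq> {1..n}" using * ab by (simp add: Pol_def)
    finally show ?thesis .
  qed
  then show ?thesis by (simp add: Pol_def)
qed

lemma P_const [simp]: "const c \<in> Pol n"
  by (auto simp: Pol_def const_def)

lemma P_sum: "(\<And>i. i \<in> A \<Longrightarrow> f i \<in> Pol n) \<Longrightarrow> sum f A \<in> Pol n"
  by (induction A rule: infinite_finite_induct) (auto intro: P_add)

lemma P_mono: "i \<le> j \<Longrightarrow> Pol i \<subseteq> Pol j"
  unfolding Pol_def by (auto dest!: bspec subsetD)

lemma pderiv_var_superset:
  assumes "finite A" "Poly_Mapping.keys p \<subseteq> A"
  shows "pderiv_var i p = (\<Sum>m\<in>A. Poly_Mapping.single (m - Poly_Mapping.single i 1)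
           (of_nat (Poly_Mapping.lookup m i) * Poly_Mapping.lookup p m))"
  unfolding pderiv_var_def
  by (rule sum.mono_neutral_left) (use assms in \<open>auto simp: in_keys_iff\<close>)

lemma pderiv_var_add: "pderiv_var i (p + q) = pderiv_var i p + pderiv_var i q"
proof -
  let ?A = "Poly_Mapping.keys p \<union> Poly_Mapping.keys q"
  have "Poly_Mapping.keys (p + q) \<subseteq> ?A" by (rule keys_add)
  then show ?thesis
    by (simp add: pderiv_var_superset[of ?A] lookup_add algebra_simps single_add sum.distrib)
qed

lemma pderiv_var_0 [simp]: "pderiv_var i 0 = 0"
  by (simp add: pderiv_var_def)

lemma pderiv_var_sum: "pderiv_var i (sum f A) = (\<Sum>a\<in>A. pderiv_var i (f a))"
  by (induction A rule: infinite_finite_induct) (auto simp: pderiv_var_add)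

lemma pderiv_var_uminus: "pderiv_var i (- p) = - pderiv_var i p"
  using pderiv_var_add[of i p "- p"] by (simp add: eq_neg_iff_add_eq_0 add.commute)

lemma pderiv_var_diff: "pderiv_var i (p - q) = pderiv_var i p - pderiv_var i q"
  using pderiv_var_add[of i p "- q"] by (simp add: pderiv_var_uminus)

lemma pderiv_var_single:
  "pderiv_var i (Poly_Mapping.single m c) =
     Poly_Mapping.single (m - Poly_Mapping.single i 1) (of_nat (Poly_Mapping.lookup m i) * c)"
  by (simp add: pderiv_var_superset[of "{m}"])

lemma mpoly_sum_singles:
  "p = (\<Sum>m\<in>Poly_Mapping.keys p. Poly_Mapping.single m (Poly_Mapping.lookup p m))"
  by (rule poly_mapping_eqI) (auto simp: lookup_sum lookup_single when_def in_keys_iff)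

lemma pderiv_var_mult_single:
  fixes c d :: "'k::comm_ring_1"
  shows "pderiv_var i (Poly_Mapping.single m c * Poly_Mapping.single l d) =
    pderiv_var i (Poly_Mapping.single m c) * Poly_Mapping.single l d +
    Poly_Mapping.single m c * pderiv_var i (Poly_Mapping.single l d)"
proof -
  let ?e = "Poly_Mapping.single i (1::nat)"
  have shift: "(a - ?e) + b = a + b - ?e" if "Poly_Mapping.lookup a i \<noteq> 0" for a b :: "nat \<Rightarrow>\<^sub>0 nat"
    by (rule poly_mapping_eqI) (use that in \<open>auto simp: lookup_add lookup_minus lookup_single when_def\<close>)
  have 1: "Poly_Mapping.single ((m - ?e) + l) (of_nat (Poly_Mapping.lookup m i) * c * d) =
      Poly_Mapping.single (m + l - ?e) (of_nat (Poly_Mapping.lookup m i) * c * d)"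
    using shift[of m l] by (cases "Poly_Mapping.lookup m i = 0") auto
  have 2: "Poly_Mapping.single (m + (l - ?e)) (c * (of_nat (Poly_Mapping.lookup l i) * d)) =
      Poly_Mapping.single (m + l - ?e) (c * (of_nat (Poly_Mapping.lookup l i) * d))"
    using shift[of l m] by (cases "Poly_Mapping.lookup l i = 0") (auto simp: add.commute)
  show ?thesis
    unfolding mult_single pderiv_var_single 1 2
    by (simp add: single_add[symmetric] lookup_add algebra_simps)
qed

lemma pderiv_var_mult: "pderiv_var i (p * q) = pderiv_var i p * q + p * pderiv_var i q"
proof -
  let ?s = "\<lambda>p m. Poly_Mapping.single m (Poly_Mapping.lookup p m)"
  let ?p = "\<Sum>m\<in>Poly_Mapping.keys p. ?s p m" and ?q = "\<Sum>m\<in>Poly_Mapping.keys q. ?s q m"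
  have "pderiv_var i (?p * ?q) = pderiv_var i ?p * ?q + ?p * pderiv_var i ?q"
    by (simp add: sum_product pderiv_var_sum pderiv_var_mult_single sum.distrib)
  then show ?thesis
    by (simp flip: mpoly_sum_singles)
qed

lemma pderiv_var_eq_0: "p \<in> Pol j \<Longrightarrow> j < i \<Longrightarrow> pderiv_var i p = 0"
proof -
  assume *: "p \<in> Pol j" "j < i"
  have "Poly_Mapping.lookup m i = 0" if "m \<in> Poly_Mapping.keys p" for m
    using * that by (fastforce simp: Pol_def in_keys_iff)
  then show ?thesis
    unfolding pderiv_var_def by (intro sum.neutral) simp
qed

lemma pderiv_var_const [simp]: "pderiv_var i (const c) = 0"
  by (simp add: const_def pderiv_var_single)

lemma P_pderiv_var: "p \<in> Pol n \<Longrightarrow> pderiv_var i p \<in> Pol n"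
  unfolding pderiv_var_def
proof (rule P_sum)
  fix m assume "p \<in> Pol n" "m \<in> Poly_Mapping.keys p"
  then have "Poly_Mapping.keys m \<subseteq> {1..n}" by (simp add: Pol_def)
  moreover have "Poly_Mapping.keys (m - Poly_Mapping.single i 1) \<subseteq> Poly_Mapping.keys m"
    by (auto simp: in_keys_iff lookup_minus)
  ultimately show "Poly_Mapping.single (m - Poly_Mapping.single i 1)
      (of_nat (Poly_Mapping.lookup m i) * Poly_Mapping.lookup p m) \<in> Pol n"
    by (auto simp: Pol_def)
qed

lemma pderiv_var_commute: "pderiv_var i (pderiv_var j p) = pderiv_var j (pderiv_var i p)"
proof -
  let ?e = "\<lambda>i. Poly_Mapping.single i (1::nat)"
  have "pderiv_var i (pderiv_var j (Poly_Mapping.single m c)) =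
        pderiv_var j (pderiv_var i (Poly_Mapping.single m c))" for m and c :: 'a
  proof (cases "i = j")
    case False
    have "m - ?e j - ?e i = m - ?e i - ?e j"
      by (rule diff_right_commute)
    then show ?thesis
      using False by (simp add: pderiv_var_single lookup_minus lookup_single mult.left_commute)
  qed simp
  then have "pderiv_var i (pderiv_var j (\<Sum>m\<in>Poly_Mapping.keys p. Poly_Mapping.single m (Poly_Mapping.lookup p m))) =
     pderiv_var j (pderiv_var i (\<Sum>m\<in>Poly_Mapping.keys p. Poly_Mapping.single m (Poly_Mapping.lookup p m)))"
    by (simp only: pderiv_var_sum)
  then show ?thesis
    by (simp flip: mpoly_sum_singles)
qed

lemma const_simps:
  "const (a + b) = const a + const b" "const (a * b) = const a * const b" "const 1 = 1"
  by (simp_all add: const_def single_add mult_single)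

lemma vector_space_scale_map:
  "vector_space (scale_map :: 'k::field \<Rightarrow> ('k mpoly \<Rightarrow> 'k mpoly) \<Rightarrow> _)"
  by unfold_locales (simp_all add: scale_map_def fun_eq_iff const_simps algebra_simps)

lemma DerD:
  assumes "\<delta> \<in> Der n"
  shows "f \<notin> Pol n \<Longrightarrow> \<delta> f = 0" "\<delta> f \<in> Pol n" "\<delta> 0 = 0"
    "f \<in> Pol n \<Longrightarrow> g \<in> Pol n \<Longrightarrow> \<delta> (f + g) = \<delta> f + \<delta> g"
    "f \<in> Pol n \<Longrightarrow> g \<in> Pol n \<Longrightarrow> \<delta> (f - g) = \<delta> f - \<delta> g"
    "f \<in> Pol n \<Longrightarrow> \<delta> (const c * f) = const c * \<delta> f"
    "f \<in> Pol n \<Longrightarrow> g \<in> Pol n \<Longrightarrow> \<delta> (f * g) = \<delta> f * g + f * \<delta> g"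
proof -
  show a: "f \<in> Pol n \<Longrightarrow> g \<in> Pol n \<Longrightarrow> \<delta> (f + g) = \<delta> f + \<delta> g" for f g
    using assms by (simp add: Der_def)
  show "\<delta> 0 = 0" using a[of 0 0] by simp
  show "f \<in> Pol n \<Longrightarrow> g \<in> Pol n \<Longrightarrow> \<delta> (f - g) = \<delta> f - \<delta> g"
    using a[of "f - g" g] by (simp add: P_diff)
  show "f \<in> Pol n \<Longrightarrow> \<delta> (const c * f) = const c * \<delta> f"
    using assms unfolding Der_def by blast
  show "\<delta> f \<in> Pol n" using assms by (cases "f \<in> Pol n") (simp_all add: Der_def)
qed (use assms in \<open>simp_all add: Der_def\<close>)

lemma lie_algebra_Der:
  "lie_algebra scale_map (Der n :: ('k::field mpoly \<Rightarrow> 'k mpoly) set) commutator"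
proof -
  interpret vector_space "scale_map :: 'k \<Rightarrow> ('k mpoly \<Rightarrow> 'k mpoly) \<Rightarrow> _"
    by (rule vector_space_scale_map)
  have sub: "subspace (Der n :: ('k mpoly \<Rightarrow> 'k mpoly) set)"
    unfolding subspace_def
    by (auto simp: Der_def scale_map_def P_add P_mult algebra_simps)
  have closed: "commutator x y \<in> Der n" if "x \<in> Der n" "y \<in> Der n" for x y :: "'k mpoly \<Rightarrow> 'k mpoly"
  proof -
    note X = DerD[OF that(1)] and Y = DerD[OF that(2)]
    show ?thesis
      unfolding Der_def mem_Collect_eq commutator_def
    proof (intro conjI allI ballI impI, goal_cases)
      case (1 f) then show ?case by (simp add: X Y)
    next
      case (2 f) then show ?case by (intro P_diff X Y)
    next
      case (3 f g) then show ?case by (simp add: X(2,4) Y(2,4))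
    next
      case (4 c f) then show ?case by (simp add: X(2,6) Y(2,6) right_diff_distrib)
    next
      case (5 f g) then show ?case
        by (simp add: X(2,4,7) Y(2,4,7) P_mult algebra_simps)
    qed
  qed
  show ?thesis
  proof (unfold_locales, goal_cases)
    case 1 show ?case by (rule sub)
  next
    case (2 x y) then show ?case by (rule closed)
  next
    case (3 x y z) then show ?case
      by (simp add: fun_eq_iff commutator_def DerD)
  next
    case (4 x y z) then show ?case
      by (simp add: fun_eq_iff commutator_def DerD)
  next
    case (5 x y c) then show ?case
      by (simp add: fun_eq_iff commutator_def scale_map_def DerD algebra_simps)
  next
    case (6 x y c) then show ?case
      by (simp add: fun_eq_iff commutator_def scale_map_def DerD algebra_simps)
  next
    case (7 x) then show ?case by (simp add: fun_eq_iff commutator_def)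
  next
    case (8 x y z) then show ?case
      by (simp add: fun_eq_iff commutator_def DerD)
  qed
qed

lemma partial_der_in_Der: "partial_der n i \<in> Der n"
  by (auto simp: Der_def partial_der_def P_pderiv_var P_add P_mult pderiv_var_add pderiv_var_mult)

lemma u_subset_Der: "\<uu> n \<subseteq> Der n"
proof
  fix x :: "'a mpoly \<Rightarrow> 'a mpoly" assume "x \<in> \<uu> n"
  then obtain p where p: "\<And>i. i \<in> {1..n} \<Longrightarrow> p i \<in> Pol (i - 1)"
    and x: "x = (\<lambda>f. \<Sum>i=1..n. p i * partial_der n i f)" unfolding \<uu>_def by blast
  have pn: "p i \<in> Pol n" if "i \<in> {1..n}" for i
  proof -
    have "i - 1 \<le> n" using that by auto
    then show ?thesis using P_mono p[OF that] by blast
  qed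
  show "x \<in> Der n"
    unfolding x Der_def mem_Collect_eq
  proof (intro conjI allI ballI impI, goal_cases)
    case (1 f) then show ?case by (simp add: DerD[OF partial_der_in_Der])
  next
    case (2 f) then show ?case by (intro P_sum P_mult pn DerD[OF partial_der_in_Der])
  next
    case (3 f g) then show ?case
      by (simp add: DerD[OF partial_der_in_Der] sum.distrib algebra_simps)
  next
    case (4 c f) then show ?case
      by (simp only: DerD(6)[OF partial_der_in_Der] sum_distrib_left mult.left_commute)
  next
    case (5 f g) then show ?case
      by (simp only: DerD(7)[OF partial_der_in_Der])
         (simp add: sum.distrib sum_distrib_left sum_distrib_right algebra_simps)
  qed
qed

lemma lie_subalgebra_u:
  "lie_algebra.lie_subalgebra scale_map (Der n) commutator (\<uu> n :: ('k::field mpoly \<Rightarrow> 'k mpoly) set)"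
proof -
  interpret lie_algebra scale_map "Der n :: ('k mpoly \<Rightarrow> 'k mpoly) set" commutator
    by (rule lie_algebra_Der)
  let ?D = "\<lambda>p f. \<Sum>i=1..n. p i * partial_der n i (f :: 'k mpoly)"
  have uI: "x \<in> \<uu> n" if "\<And>i. i \<in> {1..n} \<Longrightarrow> p i \<in> Pol (i - 1)" "\<And>f. x f = ?D p f" for x p
    using that unfolding \<uu>_def by blast
  have uE: "\<exists>p. (\<forall>i\<in>{1..n}. p i \<in> Pol (i - 1)) \<and> x = ?D p" if "x \<in> \<uu> n" for x
    using that unfolding \<uu>_def by blast
  have "subspace (\<uu> n :: ('k mpoly \<Rightarrow> 'k mpoly) set)"
  proof (rule subspaceI)
    show "(0 :: 'k mpoly \<Rightarrow> 'k mpoly) \<in> \<uu> n" by (rule uI[of "\<lambda>_. 0"]) simp_all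
  next
    fix x y :: "'k mpoly \<Rightarrow> 'k mpoly" assume x: "x \<in> \<uu> n" and y: "y \<in> \<uu> n"
    obtain p where p: "\<And>i. i \<in> {1..n} \<Longrightarrow> p i \<in> Pol (i - 1)" "x = ?D p" using uE[OF x] by blast
    obtain q where q: "\<And>i. i \<in> {1..n} \<Longrightarrow> q i \<in> Pol (i - 1)" "y = ?D q" using uE[OF y] by blast
    show "x + y \<in> \<uu> n"
      by (rule uI[of "\<lambda>i. p i + q i"]) (simp_all only: p q P_add plus_fun_apply distrib_right sum.distrib)
  next
    fix c :: 'k and x :: "'k mpoly \<Rightarrow> 'k mpoly" assume x: "x \<in> \<uu> n"
    obtain p where p: "\<And>i. i \<in> {1..n} \<Longrightarrow> p i \<in> Pol (i - 1)" "x = ?D p" using uE[OF x] by blast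
    show "scale_map c x \<in> \<uu> n"
      by (rule uI[of "\<lambda>i. const c * p i"])
         (simp_all only: p P_mult P_const scale_map_def sum_distrib_left mult.assoc)
  qed
  moreover have "commutator x y \<in> \<uu> n" if x: "x \<in> \<uu> n" and y: "y \<in> \<uu> n" for x y :: "'k mpoly \<Rightarrow> 'k mpoly"
  proof -
    obtain p where p: "\<And>i. i \<in> {1..n} \<Longrightarrow> p i \<in> Pol (i - 1)" "x = ?D p" using uE[OF x] by blast
    obtain q where q: "\<And>i. i \<in> {1..n} \<Longrightarrow> q i \<in> Pol (i - 1)" "y = ?D q" using uE[OF y] by blast
    let ?r = "\<lambda>j. \<Sum>i=1..n. p i * pderiv_var i (q j) - q i * pderiv_var i (p j)"
    have r: "?r j \<in> Pol (j - 1)" if j: "j \<in> {1..n}" for j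
    proof (rule P_sum)
      fix i assume i: "i \<in> {1..n}"
      show "p i * pderiv_var i (q j) - q i * pderiv_var i (p j) \<in> Pol (j - 1)"
      proof (cases "i < j")
        case True
        then have "Pol (i - 1) \<subseteq> (Pol (j - 1) :: 'k mpoly set)" by (intro P_mono) auto
        then show ?thesis
          using p(1)[OF i] q(1)[OF i] p(1)[OF j] q(1)[OF j]
          by (intro P_diff P_mult P_pderiv_var) auto
      next
        case False
        then have "j - 1 < i" using j by auto
        then show ?thesis
          using pderiv_var_eq_0[OF p(1)[OF j]] pderiv_var_eq_0[OF q(1)[OF j]] by simp
      qed
    qed
    have D: "?D p f = (\<Sum>i=1..n. p i * pderiv_var i f)" if "f \<in> Pol n" for p f
      using that by (simp add: partial_der_def)
    have comp: "?D a (?D b f) = (\<Sum>i=1..n. \<Sum>j=1..n. a i * (pderiv_var i (b j) * pderiv_var j f)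
        + a i * b j * pderiv_var i (pderiv_var j f))"
      if f: "f \<in> Pol n" and b: "?D b \<in> \<uu> n" for a b f
    proof -
      have "?D b f \<in> Pol n" using u_subset_Der b DerD(2) by blast
      then have "?D a (?D b f) = (\<Sum>i=1..n. a i * pderiv_var i (?D b f))" by (rule D)
      also have "\<dots> = (\<Sum>i=1..n. \<Sum>j=1..n. a i * (pderiv_var i (b j) * pderiv_var j f)
        + a i * b j * pderiv_var i (pderiv_var j f))"
        by (simp only: D[OF f] pderiv_var_sum pderiv_var_mult sum_distrib_left distrib_left mult.assoc)
      finally show ?thesis .
    qed
    show ?thesis
    proof (rule uI[of ?r])
      show "?r j \<in> Pol (j - 1)" if "j \<in> {1..n}" for j by (rule r[OF that])
      fix f :: "'k mpoly"
      show "commutator x y f = ?D ?r f"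
      proof (cases "f \<in> Pol n")
        case False
        then show ?thesis by (simp add: p q commutator_def partial_der_def)
      next
        case True
        have swap: "(\<Sum>i=1..n. \<Sum>j=1..n. q i * p j * pderiv_var i (pderiv_var j f)) =
          (\<Sum>i=1..n. \<Sum>j=1..n. p i * q j * pderiv_var i (pderiv_var j f))"
          by (subst sum.swap) (simp add: mult.commute pderiv_var_commute)
        have "commutator x y f = ?D p (?D q f) - ?D q (?D p f)"
          by (simp only: commutator_def p(2) q(2))
        also have "\<dots> = (\<Sum>i=1..n. \<Sum>j=1..n. p i * (pderiv_var i (q j) * pderiv_var j f))
           - (\<Sum>i=1..n. \<Sum>j=1..n. q i * (pderiv_var i (p j) * pderiv_var j f))"
          using x y unfolding p(2) q(2)
          by (simp only: comp[OF True] sum.distrib swap) simp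
        also have "\<dots> = (\<Sum>j=1..n. \<Sum>i=1..n. (p i * pderiv_var i (q j) - q i * pderiv_var i (p j)) * pderiv_var j f)"
          by (subst (1 2) sum.swap) (simp add: sum_subtractf left_diff_distrib mult.assoc)
        also have "\<dots> = ?D ?r f"
          using True by (simp add: partial_der_def sum_distrib_right)
        finally show ?thesis .
      qed
    qed
  qed
  ultimately show ?thesis
    unfolding lie_subalgebra_def using u_subset_Der by blast
qed

lemma lie_algebra_u:
  "lie_algebra scale_map (\<uu> n :: ('k::field mpoly \<Rightarrow> 'k mpoly) set) commutator"
  by (rule lie_algebra.lie_algebra_subalgebra[OF lie_algebra_Der lie_subalgebra_u])

end

theory Submission
  imports Defs
begin

text \<open>
  Give \<open>x\<^sub>i\<close> the weight \<open>b\<^sup>i\<close>. A coefficient \<open>p\<^sub>i\<close> of an element \<open>\<Sum>\<^sub>i p\<^sub>i \<partial>\<^sub>i\<close> of \<open>\<uu> n\<close> only involves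
  variables before \<open>x\<^sub>i\<close>, so if \<open>b\<close> exceeds the total degree of \<open>p\<^sub>i\<close>, then all monomials of \<open>p\<^sub>i\<close> weigh
  less than \<open>x\<^sub>i\<close>, and \<open>p\<^sub>i \<partial>\<^sub>i\<close> strictly lowers weights. Hence one \<open>b\<close> can be chosen such that
  finitely many given elements all lie in the set \<open>M\<^sub>1\<close>, where \<open>M\<^sub>k\<close> (\<open>lowering n b k\<close>) consists of
  those elements of \<open>\<uu> n\<close> which lower the weight of every polynomial by at least \<open>k\<close>.

  Composing operators adds up the amounts by which they lower weights, so \<open>[M\<^sub>k, M\<^sub>l] \<subseteq> M\<^bsub>k+l\<^esub>\<close>; in
  particular \<open>M\<^sub>1\<close> is a subalgebra, and it contains the subalgebra generated by the given elements.
  An element of \<open>\<uu> n\<close> is determined by its values on the variables, which are its coefficients.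
  The variables weigh at most \<open>b\<^sup>n\<close>, so for \<open>k > b\<^sup>n\<close> the elements of \<open>M\<^sub>k\<close> kill all of them and
  \<open>M\<^sub>k = 0\<close>, which makes \<open>M\<^sub>1\<close> nilpotent (\<open>lowering_eq_0\<close>, \<open>nilpotent_of_filtration\<close>). The
  coefficients of elements of \<open>M\<^sub>1\<close> are lighter than the corresponding variables, and only finitely
  many monomials are, so \<open>M\<^sub>1\<close> is finite dimensional (\<open>lowering_in_finite_span\<close>). Both properties
  pass to subalgebras.
\<close>

section \<open>Subalgebras generated inside a given subalgebra\<close>

lemma (in vector_space) subspace_of_finite_span:
  assumes "subspace S" "finite B" "S \<subseteq> span B"
  shows "\<exists>C. finite C \<and> S = span C"
proof -
  obtain C where C: "C \<subseteq> S" "independent C" "S \<subseteq> span C"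
    by (rule basis_exists[of S])
  have "finite C"
    using independent_span_bound[of B C] assms(2,3) C by auto
  moreover have "span C \<subseteq> S"
    using C(1) assms(1) by (rule span_minimal)
  ultimately show ?thesis
    using C(3) by blast
qed

context lie_algebra
begin

lemma subspace_lie_hull:
  "subspace (lie_subalgebra hull X)"
  unfolding hull_def by (rule subspace_Inter) (auto simp: lie_subalgebra_def)

lemma lie_hull_finite_dimensional:
  assumes "lie_subalgebra M" "X \<subseteq> M" "finite B" "M \<subseteq> span B"
  shows "finite_dimensional (lie_subalgebra hull X)"
proof -
  have "lie_subalgebra hull X \<subseteq> span B"
    using hull_minimal[OF assms(2), of lie_subalgebra] assms(1,4) by blast
  then show ?thesis
    unfolding finite_dimensional_def
    by (rule subspace_of_finite_span[OF subspace_lie_hull assms(3)])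
qed

text \<open>The lower central series of \<open>M\<close> descends at least as fast as \<open>F\<close>.\<close>

lemma nilpotent_of_filtration:
  assumes sub: "\<And>k. subspace (F k)"
    and bracket: "\<And>k x y. x \<in> F 0 \<Longrightarrow> y \<in> F k \<Longrightarrow> bracket x y \<in> F (Suc k)"
    and zero: "F N \<subseteq> {0}" and M: "subspace M" "M \<subseteq> F 0"
  shows "nilpotent M"
proof -
  have "lower_central M k \<subseteq> F k" for k
  proof (induction k)
    case 0
    show ?case using M by simp
  next
    case (Suc k)
    then have "{bracket x y | x y. x \<in> M \<and> y \<in> lower_central M k} \<subseteq> F (Suc k)"
      using M(2) bracket by blast
    then show ?case
      unfolding lower_central.simps using sub by (rule span_minimal)
  qed
  then have "lower_central M N \<subseteq> {0}"
    using zero by blast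
  moreover have "0 \<in> lower_central M N"
    using M by (cases N) (simp_all add: subspace_0 span_zero)
  ultimately show ?thesis
    unfolding nilpotent_def by blast
qed

end


section \<open>Weights of monomials and polynomials\<close>

definition weight :: "nat \<Rightarrow> nat \<Rightarrow> (nat \<Rightarrow>\<^sub>0 nat) \<Rightarrow> nat" where
  "weight n b m = (\<Sum>k=1..n. Poly_Mapping.lookup m k * b ^ k)"

text \<open>
  The bound is strict so that \<open>weight_below n b 0\<close> contains only \<open>0\<close>: then truncated subtraction of
  natural numbers correctly describes what happens to a polynomial whose weight is lowered too far.
\<close>

definition weight_below :: "nat \<Rightarrow> nat \<Rightarrow> nat \<Rightarrow> 'k::zero mpoly set" where
  "weight_below n b j = {p \<in> Pol n. \<forall>m\<in>Poly_Mapping.keys p. weight n b m < j}"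

lemma weight_add: "weight n b (l + m) = weight n b l + weight n b m"
  by (simp add: weight_def lookup_add algebra_simps sum.distrib)

lemma weight_single:
  "i \<in> {1..n} \<Longrightarrow> weight n b (Poly_Mapping.single i 1) = b ^ i"
  by (simp add: weight_def lookup_single when_def if_distrib[of "\<lambda>c. c * _"] cong: if_cong)

lemma weight_diff_single:
  assumes "i \<in> {1..n}" "Poly_Mapping.lookup m i \<noteq> 0"
  shows "weight n b (m - Poly_Mapping.single i 1) + b ^ i = weight n b m"
proof -
  have "(m - Poly_Mapping.single i 1) + Poly_Mapping.single i 1 = m"
    by (rule poly_mapping_eqI)
      (use assms(2) in \<open>auto simp: lookup_add lookup_minus lookup_single when_def\<close>)
  then show ?thesis
    using weight_add[of n b "m - Poly_Mapping.single i 1" "Poly_Mapping.single i 1"]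
      weight_single[OF assms(1), of b]
    by simp
qed

text \<open>
  For \<open>b\<close> larger than the total degree of \<open>m\<close>, the weight of \<open>m\<close> is at most its degree times the
  largest weight \<open>b\<^bsup>i-1\<^esup>\<close> of a variable in it.
\<close>

lemma eventually_weight_less:
  assumes "i \<ge> 1" "Poly_Mapping.keys m \<subseteq> {1..i - 1}"
  shows "eventually (\<lambda>b. weight n b m < b ^ i) sequentially"
proof -
  let ?d = "\<Sum>k=1..n. Poly_Mapping.lookup m k"
  have "weight n b m < b ^ i" if b: "?d < b" for b
  proof -
    have "Poly_Mapping.lookup m k * b ^ k \<le> Poly_Mapping.lookup m k * b ^ (i - 1)" for k
    proof (cases "k \<in> Poly_Mapping.keys m")
      case True
      then have "k \<le> i - 1" using assms(2) by auto
      then show ?thesis using b by (intro mult_left_mono power_increasing) auto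
    qed (simp add: in_keys_iff)
    then have "weight n b m \<le> ?d * b ^ (i - 1)"
      unfolding weight_def sum_distrib_right by (rule sum_mono)
    also have "\<dots> < b * b ^ (i - 1)"
      using b by simp
    also have "\<dots> = b ^ i"
      using assms(1) by (simp flip: power_Suc)
    finally show ?thesis .
  qed
  then show ?thesis
    unfolding eventually_at_top_dense by blast
qed

lemma finite_monomials_of_bounded_weight:
  assumes "b \<ge> 1"
  shows "finite {m. Poly_Mapping.keys m \<subseteq> {1..n} \<and> weight n b m < N}" (is "finite ?S")
proof -
  let ?F = "{f. \<forall>k. (k \<in> {1..n} \<longrightarrow> f k \<in> {..N}) \<and> (k \<notin> {1..n} \<longrightarrow> f k = (0::nat))}"
  have "Poly_Mapping.lookup m k \<le> N" if "weight n b m < N" "k \<in> {1..n}" for m k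
  proof -
    have "Poly_Mapping.lookup m k \<le> Poly_Mapping.lookup m k * b ^ k"
      using assms by simp
    also have "\<dots> \<le> weight n b m"
      unfolding weight_def using that(2) by (intro member_le_sum) auto
    finally show ?thesis using that(1) by simp
  qed
  moreover have "Poly_Mapping.lookup m k = 0"
    if "Poly_Mapping.keys m \<subseteq> {1..n}" "k \<notin> {1..n}" for m :: "nat \<Rightarrow>\<^sub>0 nat" and k
    using that by (auto simp: in_keys_iff subset_iff)
  ultimately have "Poly_Mapping.lookup ` ?S \<subseteq> ?F"
    by (auto simp del: atLeastAtMost_iff)
  moreover have "finite ?F"
    by (rule finite_set_of_finite_funs) auto
  ultimately have "finite (Poly_Mapping.lookup ` ?S)"
    by (rule finite_subset)
  then show ?thesis
    by (rule finite_imageD) (simp add: inj_on_def poly_mapping.lookup_inject)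
qed

lemma weight_below_0: "weight_below n b 0 = {0}"
  by (auto simp: weight_below_def)

lemma weight_below_mono: "i \<le> j \<Longrightarrow> weight_below n b i \<subseteq> weight_below n b j"
  by (fastforce simp: weight_below_def)

lemma zero_in_weight_below [simp]: "0 \<in> weight_below n b j"
  by (simp add: weight_below_def)

lemma weight_below_add:
  "f \<in> weight_below n b j \<Longrightarrow> g \<in> weight_below n b j \<Longrightarrow> f + g \<in> weight_below n b j"
  using keys_add[of f g] by (auto simp: weight_below_def P_add)

lemma weight_below_diff:
  "f \<in> weight_below n b j \<Longrightarrow> g \<in> weight_below n b j \<Longrightarrow> f - g \<in> weight_below n b j"
  for f :: "'k::comm_ring_1 mpoly"
  using keys_diff[of f g] by (auto simp: weight_below_def P_diff)

lemma weight_below_const_mult: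
  fixes f :: "'k::comm_ring_1 mpoly"
  assumes "f \<in> weight_below n b j"
  shows "const c * f \<in> weight_below n b j"
proof -
  have "Poly_Mapping.keys (const c) \<subseteq> {0}"
    by (auto simp: const_def split: if_splits)
  then have "Poly_Mapping.keys (const c * f) \<subseteq> Poly_Mapping.keys f"
    using keys_mult[of "const c" f] by fastforce
  then show ?thesis
    using assms by (auto simp: weight_below_def intro: P_mult[OF P_const])
qed

lemma weight_below_sum:
  "(\<And>i. i \<in> A \<Longrightarrow> f i \<in> weight_below n b j) \<Longrightarrow> sum f A \<in> weight_below n b j"
  by (induction A rule: infinite_finite_induct) (auto intro: weight_below_add)

lemma variable_in_weight_below:
  "i \<in> {1..n} \<Longrightarrow> Poly_Mapping.single (Poly_Mapping.single i 1) 1 \<in> weight_below n b (Suc (b ^ i))"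
  using weight_single[of i n b] by (simp add: weight_below_def Pol_def)

lemma keys_pderiv_var:
  assumes "m \<in> Poly_Mapping.keys (pderiv_var i f)"
  obtains l where "l \<in> Poly_Mapping.keys f" "Poly_Mapping.lookup l i \<noteq> 0"
    "m = l - Poly_Mapping.single i 1"
proof -
  let ?t = "\<lambda>l. Poly_Mapping.single (l - Poly_Mapping.single i 1)
    (of_nat (Poly_Mapping.lookup l i) * Poly_Mapping.lookup f l)"
  have "m \<in> (\<Union>l\<in>Poly_Mapping.keys f. Poly_Mapping.keys (?t l))"
    using assms keys_sum[of ?t "Poly_Mapping.keys f"] unfolding pderiv_var_def by (rule subsetD[rotated])
  then obtain l where l: "l \<in> Poly_Mapping.keys f" "m \<in> Poly_Mapping.keys (?t l)"
    by (rule UN_E)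
  have "Poly_Mapping.lookup l i \<noteq> 0"
    using l(2) by (cases "Poly_Mapping.lookup l i = 0") auto
  then show ?thesis
    using that l by (auto split: if_splits)
qed

text \<open>
  A monomial of \<open>p * pderiv_var i f\<close> arises from one of \<open>f\<close> by replacing a factor \<open>x\<^sub>i\<close>, of weight
  \<open>b\<^sup>i\<close>, with a monomial of \<open>p\<close>, which is lighter.
\<close>

lemma mult_pderiv_var_lowers_weight:
  assumes i: "i \<in> {1..n}" and p: "p \<in> weight_below n b (b ^ i)"
    and f: "f \<in> weight_below n b j"
  shows "p * pderiv_var i f \<in> weight_below n b (j - 1)"
proof -
  have "weight n b m < j - 1" if m: "m \<in> Poly_Mapping.keys (p * pderiv_var i f)" for m
  proof -
    obtain a c where a: "m = a + c" "a \<in> Poly_Mapping.keys p"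
      and c: "c \<in> Poly_Mapping.keys (pderiv_var i f)"
      using m keys_mult[of p "pderiv_var i f"] by blast
    obtain l where l: "l \<in> Poly_Mapping.keys f" "Poly_Mapping.lookup l i \<noteq> 0"
      "c = l - Poly_Mapping.single i 1"
      using c by (rule keys_pderiv_var)
    have "weight n b c + b ^ i = weight n b l"
      unfolding l(3) using i l(2) by (rule weight_diff_single)
    moreover have "weight n b a < b ^ i" "weight n b l < j"
      using p f a(2) l(1) by (auto simp: weight_below_def)
    ultimately show ?thesis
      by (simp add: a(1) weight_add)
  qed
  moreover have "p * pderiv_var i f \<in> Pol n"
    using p f by (intro P_mult P_pderiv_var) (simp_all add: weight_below_def)
  ultimately show ?thesis
    by (simp add: weight_below_def)
qed


section \<open>The filtration by weight-lowering derivations\<close>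

definition lowering :: "nat \<Rightarrow> nat \<Rightarrow> nat \<Rightarrow> ('k::comm_ring_1 mpoly \<Rightarrow> 'k mpoly) set" where
  "lowering n b k = {\<delta> \<in> \<uu> n. \<forall>j. \<forall>f \<in> weight_below n b j. \<delta> f \<in> weight_below n b (j - k)}"

lemma lowering_antimono:
  "k \<le> l \<Longrightarrow> lowering n b l \<subseteq> (lowering n b k :: ('k::comm_ring_1 mpoly \<Rightarrow> 'k mpoly) set)"
proof -
  assume "k \<le> l"
  then have "weight_below n b (j - l) \<subseteq> (weight_below n b (j - k) :: 'k mpoly set)" for j
    by (intro weight_below_mono diff_le_mono2)
  then show ?thesis
    unfolding lowering_def by blast
qed

lemma subspace_u:
  "module.subspace scale_map (\<uu> n :: ('k::field mpoly \<Rightarrow> 'k mpoly) set)"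
  by (rule lie_algebra.subspace_carrier[OF lie_algebra_u])

lemma subspace_lowering:
  "module.subspace scale_map (lowering n b k :: ('k::field mpoly \<Rightarrow> 'k mpoly) set)"
proof -
  interpret vector_space "scale_map :: 'k \<Rightarrow> ('k mpoly \<Rightarrow> 'k mpoly) \<Rightarrow> _"
    by (rule vector_space_scale_map)
  show ?thesis
    using subspace_u[of n, where ?'k = 'k]
    unfolding subspace_def lowering_def
    by (auto simp: scale_map_def weight_below_add weight_below_const_mult)
qed

text \<open>
  Both products of \<open>\<delta>\<close> and \<open>\<epsilon>\<close> as operators
  already lower weights by \<open>k + l\<close>.
\<close>

lemma commutator_lowering:
  fixes \<delta> \<epsilon> :: "'k::field mpoly \<Rightarrow> 'k mpoly"
  assumes "\<delta> \<in> lowering n b k" "\<epsilon> \<in> lowering n b l"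
  shows "commutator \<delta> \<epsilon> \<in> lowering n b (k + l)"
proof -
  have "commutator \<delta> \<epsilon> \<in> \<uu> n"
    using lie_algebra.bracket_closed[OF lie_algebra_u] assms by (auto simp: lowering_def)
  moreover have "commutator \<delta> \<epsilon> f \<in> weight_below n b (j - (k + l))"
    if f: "f \<in> weight_below n b j" for j f
  proof -
    have "\<delta> (\<epsilon> f) \<in> weight_below n b (j - l - k)" "\<epsilon> (\<delta> f) \<in> weight_below n b (j - k - l)"
      using assms f unfolding lowering_def by blast+
    then show ?thesis
      unfolding commutator_def by (intro weight_below_diff) (simp_all add: add.commute)
  qed
  ultimately show ?thesis
    by (simp add: lowering_def)
qed

lemma lie_subalgebra_lowering:
  "lie_algebra.lie_subalgebra scale_map (\<uu> n) commutator
     (lowering n b 1 :: ('k::field mpoly \<Rightarrow> 'k mpoly) set)"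
proof -
  have "commutator \<delta> \<epsilon> \<in> lowering n b 1"
    if "\<delta> \<in> lowering n b 1" "\<epsilon> \<in> lowering n b 1" for \<delta> \<epsilon> :: "'k mpoly \<Rightarrow> 'k mpoly"
    using commutator_lowering[OF that] lowering_antimono[of 1 "1 + 1" n b] by auto
  then show ?thesis
    unfolding lie_algebra.lie_subalgebra_def[OF lie_algebra_u]
    using subspace_lowering by (auto simp: lowering_def)
qed

text \<open>The coefficients of an element of \<open>\<uu> n\<close> are its values on the variables.\<close>

lemma u_cases:
  assumes "\<delta> \<in> \<uu> n"
  obtains p where "\<And>i. i \<in> {1..n} \<Longrightarrow> p i \<in> Pol (i - 1)"
    "\<delta> = (\<lambda>f. \<Sum>i=1..n. p i * partial_der n i f)"
    "\<And>i. i \<in> {1..n} \<Longrightarrow> \<delta> (Poly_Mapping.single (Poly_Mapping.single i 1) 1) = p i"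
proof -
  obtain p where p: "\<And>i. i \<in> {1..n} \<Longrightarrow> p i \<in> Pol (i - 1)"
    "\<delta> = (\<lambda>f. \<Sum>i=1..n. p i * partial_der n i f)"
    using assms unfolding \<uu>_def by blast
  have "\<delta> (Poly_Mapping.single (Poly_Mapping.single i 1) 1) = p i" if i: "i \<in> {1..n}" for i
  proof -
    let ?x = "Poly_Mapping.single (Poly_Mapping.single i (1::nat)) (1::'a)"
    have "?x \<in> Pol n"
      using i by (auto simp: Pol_def split: if_splits)
    then have "p k * partial_der n k ?x = (if k = i then p i else 0)" for k
      by (simp add: partial_der_def pderiv_var_single lookup_single when_def)
    then show ?thesis
      using i by (simp add: p(2))
  qed
  with p show ?thesis
    by (rule that)
qed

text \<open>
  Each of the finitely many monomials in the coefficients of \<open>\<delta>\<close> imposes a condition that holds for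
  all large \<open>b\<close>. Stating this with \<open>eventually\<close> lets finitely many elements share one \<open>b\<close>.
\<close>

lemma eventually_in_lowering:
  assumes "\<delta> \<in> \<uu> n"
  shows "eventually (\<lambda>b. \<delta> \<in> lowering n b 1) sequentially"
proof -
  obtain p where p: "\<And>i. i \<in> {1..n} \<Longrightarrow> p i \<in> Pol (i - 1)"
    "\<delta> = (\<lambda>f. \<Sum>i=1..n. p i * partial_der n i f)"
    using assms by (rule u_cases) blast
  have "eventually (\<lambda>b. \<forall>i\<in>{1..n}. \<forall>m\<in>Poly_Mapping.keys (p i). weight n b m < b ^ i) sequentially"
    using p(1) by (intro eventually_ball_finite ballI eventually_weight_less) (auto simp: Pol_def)
  then show ?thesis
  proof eventually_elim
    case (elim b)
    have light: "p i \<in> weight_below n b (b ^ i)" if i: "i \<in> {1..n}" for i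
    proof -
      have "p i \<in> Pol n"
        by (rule subsetD[OF P_mono p(1)[OF i]]) (use i in auto)
      then show ?thesis
        using elim i by (auto simp: weight_below_def)
    qed
    have "\<delta> f \<in> weight_below n b (j - 1)" if f: "f \<in> weight_below n b j" for j f
      unfolding p(2)
    proof (rule weight_below_sum)
      fix i assume i: "i \<in> {1..n}"
      have "f \<in> Pol n"
        using f by (simp add: weight_below_def)
      then show "p i * partial_der n i f \<in> weight_below n b (j - 1)"
        using mult_pderiv_var_lowers_weight[OF i light[OF i] f] by (simp add: partial_der_def)
    qed
    then show ?case
      using assms by (simp add: lowering_def)
  qed
qed

text \<open>No variable weighs more than \<open>b\<^sup>n\<close>, so an element of \<open>lowering n b N\<close> kills every variable.\<close>

lemma lowering_eq_0:
  assumes b: "b \<ge> 1" and N: "b ^ n < N"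
  shows "lowering n b N \<subseteq> {0}"
proof
  fix \<delta> :: "'a mpoly \<Rightarrow> 'a mpoly"
  assume \<delta>: "\<delta> \<in> lowering n b N"
  then have "\<delta> \<in> \<uu> n" by (simp add: lowering_def)
  then obtain p where p: "\<delta> = (\<lambda>f. \<Sum>i=1..n. p i * partial_der n i f)"
    "\<And>i. i \<in> {1..n} \<Longrightarrow> \<delta> (Poly_Mapping.single (Poly_Mapping.single i 1) 1) = p i"
    by (rule u_cases) blast
  have "p i = 0" if i: "i \<in> {1..n}" for i
  proof -
    have "b ^ i \<le> b ^ n"
      using b i by (intro power_increasing) auto
    then have "Suc (b ^ i) - N = 0"
      using N by simp
    then have "p i \<in> weight_below n b 0"
      using \<delta> variable_in_weight_below[OF i, of b] unfolding p(2)[OF i, symmetric] lowering_def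
      by fastforce
    then show ?thesis
      by (simp add: weight_below_0)
  qed
  then show "\<delta> \<in> {0}"
    by (simp add: p(1) fun_eq_iff)
qed

text \<open>
  The coefficient at \<open>\<partial>\<^sub>i\<close> is the value on \<open>x\<^sub>i\<close>, hence a combination of monomials lighter than
  \<open>x\<^sub>i\<close>; the finite spanning set consists of the products of such a monomial with \<open>\<partial>\<^sub>i\<close>.
\<close>

lemma lowering_in_finite_span:
  assumes b: "b \<ge> 1"
  shows "\<exists>B. finite B \<and>
    (lowering n b 1 :: ('k::field mpoly \<Rightarrow> 'k mpoly) set) \<subseteq> module.span scale_map B"
proof -
  interpret vector_space "scale_map :: 'k \<Rightarrow> ('k mpoly \<Rightarrow> 'k mpoly) \<Rightarrow> _"
    by (rule vector_space_scale_map)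
  define E :: "nat \<Rightarrow> (nat \<Rightarrow>\<^sub>0 nat) \<Rightarrow> 'k mpoly \<Rightarrow> 'k mpoly"
    where "E = (\<lambda>i m f. Poly_Mapping.single m 1 * partial_der n i f)"
  define S where "S = (SIGMA i:{1..n}. {m. Poly_Mapping.keys m \<subseteq> {1..n} \<and> weight n b m < b ^ i})"
  let ?B = "(\<lambda>(i, m). E i m) ` S"
  have "finite ?B"
    unfolding S_def using finite_monomials_of_bounded_weight[OF b] by (intro finite_imageI finite_SigmaI) auto
  moreover have "\<delta> \<in> span ?B" if \<delta>: "\<delta> \<in> lowering n b 1" for \<delta> :: "'k mpoly \<Rightarrow> 'k mpoly"
  proof -
    have "\<delta> \<in> \<uu> n" using \<delta> by (simp add: lowering_def)
    then obtain p where p: "\<delta> = (\<lambda>f. \<Sum>i=1..n. p i * partial_der n i f)"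
      "\<And>i. i \<in> {1..n} \<Longrightarrow> \<delta> (Poly_Mapping.single (Poly_Mapping.single i 1) 1) = p i"
      by (rule u_cases) blast
    have light: "p i \<in> weight_below n b (b ^ i)" if i: "i \<in> {1..n}" for i
      using \<delta> variable_in_weight_below[OF i, of b] unfolding p(2)[OF i, symmetric] lowering_def
      by fastforce
    have "E i m \<in> ?B" if "i \<in> {1..n}" "m \<in> Poly_Mapping.keys (p i)" for i m
      using light[OF that(1)] that by (force simp: S_def weight_below_def Pol_def)
    then have "(\<Sum>i=1..n. \<Sum>m\<in>Poly_Mapping.keys (p i). scale_map (Poly_Mapping.lookup (p i) m) (E i m))
        \<in> span ?B"
      by (intro span_sum span_scale span_base)
    also have "(\<Sum>i=1..n. \<Sum>m\<in>Poly_Mapping.keys (p i). scale_map (Poly_Mapping.lookup (p i) m) (E i m)) = \<delta>"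
    proof
      fix f
      have sum_apply: "sum g A f = (\<Sum>a\<in>A. g a f)" for g :: "'b \<Rightarrow> 'k mpoly \<Rightarrow> 'k mpoly" and A
        by (induction A rule: infinite_finite_induct) auto
      have "(\<Sum>m\<in>Poly_Mapping.keys (p i). scale_map (Poly_Mapping.lookup (p i) m) (E i m) f)
          = p i * partial_der n i f" for i
      proof -
        have "scale_map (Poly_Mapping.lookup (p i) m) (E i m) f
            = Poly_Mapping.single m (Poly_Mapping.lookup (p i) m) * partial_der n i f" for m
          by (simp add: scale_map_def E_def const_def mult_single flip: mult.assoc)
        then have "(\<Sum>m\<in>Poly_Mapping.keys (p i). scale_map (Poly_Mapping.lookup (p i) m) (E i m) f)
            = (\<Sum>m\<in>Poly_Mapping.keys (p i). Poly_Mapping.single m (Poly_Mapping.lookup (p i) m))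
              * partial_der n i f"
          by (simp only: sum_distrib_right)
        then show ?thesis
          by (simp only: mpoly_sum_singles[symmetric])
      qed
      then show "(\<Sum>i=1..n. \<Sum>m\<in>Poly_Mapping.keys (p i).
          scale_map (Poly_Mapping.lookup (p i) m) (E i m)) f = \<delta> f"
        by (simp add: sum_apply p(1))
    qed
    finally show ?thesis .
  qed
  ultimately show ?thesis by blast
qed


section \<open>Local finiteness and local nilpotency\<close>

theorem theorem4p2:
  fixes n :: nat
  assumes "n \<ge> 2"
  shows "lie_algebra.locally_finite_dimensional scale_map
           (\<uu> n :: ('k::field_char_0 mpoly \<Rightarrow> 'k mpoly) set) commutator
       \<and> lie_algebra.locally_nilpotent scale_map
           (\<uu> n :: ('k mpoly \<Rightarrow> 'k mpoly) set) commutator"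
proof -
  interpret lie_algebra scale_map "\<uu> n :: ('k mpoly \<Rightarrow> 'k mpoly) set" commutator
    by (rule lie_algebra_u)
  have "finite_dimensional M \<and> nilpotent M"
    if fg: "finitely_generated M" for M :: "('k mpoly \<Rightarrow> 'k mpoly) set"
  proof -
    obtain X where X: "finite X" "X \<subseteq> \<uu> n" and M: "M = lie_subalgebra hull X"
      using fg unfolding finitely_generated_def by blast
    have "eventually (\<lambda>b. \<forall>x\<in>X. x \<in> lowering n b 1) sequentially"
      using X by (intro eventually_ball_finite ballI eventually_in_lowering) auto
    then have "eventually (\<lambda>b. b \<ge> 1 \<and> X \<subseteq> lowering n b 1) sequentially"
      using eventually_ge_at_top[of 1] by eventually_elim auto
    then obtain b where b: "b \<ge> 1" and Xb: "X \<subseteq> lowering n b 1"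
      by (metis (no_types, lifting) eventually_happens' sequentially_bot)
    have "M \<subseteq> lowering n b 1"
      unfolding M using Xb lie_subalgebra_lowering by (rule hull_minimal)
    moreover have "subspace M"
      unfolding M by (rule subspace_lie_hull)
    moreover have "lowering n b (Suc (b ^ n)) \<subseteq> ({0} :: ('k mpoly \<Rightarrow> 'k mpoly) set)"
      using b by (rule lowering_eq_0) simp
    ultimately have "nilpotent M"
      using subspace_lowering commutator_lowering[of _ n b 1]
      by (intro nilpotent_of_filtration[of "\<lambda>k. lowering n b (Suc k)" "b ^ n"]) auto
    moreover have "finite_dimensional M"
      using lowering_in_finite_span[OF b, of n, where ?'k = 'k]
      unfolding M by (elim exE conjE) (rule lie_hull_finite_dimensional[OF lie_subalgebra_lowering Xb])
    ultimately show ?thesis by simp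
  qed
  then show ?thesis
    by (simp add: locally_finite_dimensional_def locally_nilpotent_def)
qed

end
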